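(* Let $\tau_i=\langle G_i,D_i,T_i\rangle$, $D_i\le T_i$, be a task in a set of sporadic DAG tasks scheduled by a fully preemptive global fixed task priority scheduler on $m$ identical unit-capacity cores. Assume $\tau_i$ has no carry-in, i.e. it has no pending workload at the beginning of a time window of length $\Delta$. Then an upper bound on the workload request of $\tau_i$ in this window (the total amount of execution of nodes of $\tau_i$ in the window) is $$W_i^{\mathrm{NC}}(\Delta)=\max_{\phi\in[0,C_i^{\mathrm{crit}}]}\left\{F_i^{\mathrm{U\text{-}NC}}(\Delta+\phi)-F_i^{\mathrm{L\text{-}NC}}(\phi)\right\},$$ with $F_i^{\mathrm{U\text{-}NC}}$, $F_i^{\mathrm{L\text{-}NC}}$ and $C_i^{\mathrm{crit}}$ as defined in the context.
   Context: **Task model.** A sporadic DAG task $\tau_i=\langle G_i,D_i,T_i\rangle$ consists of a directed acyclic graph $G_i$ with nodes $\tau_i^1,\dots,\tau_i^{n_i}$, having a single entry node $\tau_i^1$ (no parents) and a single exit node $\tau_i^{\mathrm{last}}$ (no children), a relative deadline $D_i$, and a minimum time $T_i$ between two consecutive activations (releases). At each activation, every node $\tau_i^j$ must be executed for an amount $c_i^j\in[c_{i,\min}^j,c_{i,\max}^j]$. A node may start only after all its parents (of the same activation) have completed; each node executes on at most one core at any time. $pred(\tau_i^j)$ and $succ(\tau_i^j)$ are the sets of (immediate) parents and children of $\tau_i^j$. **Scheduler.** There are $m$ identical unit-speed cores. Each task has a fixed priority (lower index = higher priority), inherited by all of its nodes. Under the fully preemptive global fixed task priority scheduler, different nodes of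 the same task may run on different cores, and a preempted node may resume on any core at no cost. At every instant the highest-priority ready nodes execute on the cores (at most $m$ of them), and no core idles while a ready node waits. **Derived quantities.** $C_i=\sum_{j=1}^{n_i}c_{i,\max}^j$ is the total worst-case execution requirement. $C_i^{\mathrm{crit}}$ is the critical path length: the maximum over directed paths in $G_i$ of the sum of the worst-case execution requirements $c_{i,\max}^j$ of the nodes on the path. Earliest release times: $e_i^1=0$ and $e_i^j=\max_{\tau_i^x\in pred(\tau_i^j)}\{e_i^x+c_{i,\min}^x\}$. Latest release times (relative to the start of $\tau_i^1$): $\ell_i^{\mathrm{last}'}=0$, $\ell_i^{j'}=\min_{\tau_i^x\in succ(\tau_i^j)}\{\ell_i^{x'}\}-c_{i,\max}^j$ for the other nodes, and $\ell_i^j=\ell_i^{j'}-\ell_i^{1'}$. For $t\ge 0$, $$f^U_{i,j}(t)=\min\big(\max((t\bmod T_i)-e_i^j,0),c_{i,\max}^j\big),$$ $$f^L_{i,j}(t)=\min\big(\max((t\bmod T_i)-\ell_i^j,0),c_{i,\max}^j\big),$$ and for $X\in\{U,L\}$, $$F_i^{X\text{-}\mathrm{NC}}(t)=\left\lfloor\frac{t}{T_i}\right\rfloor C_i+\sum_{\tau_i^j\in G_i}f^X_{i,j}(t\bmod T_i).$$ *)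

theory Defs
  imports "HOL-Analysis.Analysis" "HOL-Library.Real_Mod"
begin

section \<open>Sporadic DAG tasks\<close>

text \<open>The nodes of a task are the numbers from 1 to \<open>num_nodes\<close>; node 1 is the entry node.\<close>

record dag_task =
  num_nodes :: nat
  edges :: "(nat \<times> nat) set"
  exit_node :: nat
  cmin :: "nat \<Rightarrow> real"
  cmax :: "nat \<Rightarrow> real"
  deadline :: real
  period :: real

definition nodes :: "dag_task \<Rightarrow> nat set" where
  "nodes \<tau> = {1..num_nodes \<tau>}"

definition preds :: "dag_task \<Rightarrow> nat \<Rightarrow> nat set" where
  "preds \<tau> j = {x. (x, j) \<in> edges \<tau>}"

definition succs :: "dag_task \<Rightarrow> nat \<Rightarrow> nat set" where
  "succs \<tau> j = {x. (j, x) \<in> edges \<tau>}"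

definition sporadic_dag_task :: "dag_task \<Rightarrow> bool" where
  "sporadic_dag_task \<tau> \<longleftrightarrow>
     edges \<tau> \<subseteq> nodes \<tau> \<times> nodes \<tau> \<and> acyclic (edges \<tau>) \<and>
     {j \<in> nodes \<tau>. preds \<tau> j = {}} = {1} \<and>
     {j \<in> nodes \<tau>. succs \<tau> j = {}} = {exit_node \<tau>} \<and>
     (\<forall>j\<in>nodes \<tau>. 0 \<le> cmin \<tau> j \<and> cmin \<tau> j \<le> cmax \<tau> j) \<and>
     0 < deadline \<tau> \<and> 0 < period \<tau>"

definition total_wcet :: "dag_task \<Rightarrow> real" where
  "total_wcet \<tau> = (\<Sum>j\<in>nodes \<tau>. cmax \<tau> j)"

definition dag_paths :: "dag_task \<Rightarrow> nat list set" where
  "dag_paths \<tau> =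
     {p. p \<noteq> [] \<and> set p \<subseteq> nodes \<tau> \<and> successively (\<lambda>x y. (x, y) \<in> edges \<tau>) p}"

definition crit_length :: "dag_task \<Rightarrow> real" where
  "crit_length \<tau> = Max ((\<lambda>p. \<Sum>j\<leftarrow>p. cmax \<tau> j) ` dag_paths \<tau>)"

text \<open>Release times by recursion along the edges, from the entry node and from the exit node
  respectively; the recursion equations are the lemmas \<open>earliest_*\<close> and \<open>latest'_*\<close> below.\<close>

definition earliest :: "dag_task \<Rightarrow> nat \<Rightarrow> real" where
  "earliest \<tau> = wfrec (edges \<tau>)
     (\<lambda>e j. if j = 1 then 0 else Max ((\<lambda>x. e x + cmin \<tau> x) ` preds \<tau> j))"

definition latest' :: "dag_task \<Rightarrow> nat \<Rightarrow> real" where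
  "latest' \<tau> = wfrec ((edges \<tau>)\<inverse>)
     (\<lambda>l j. if j = exit_node \<tau> then 0 else Min (l ` succs \<tau> j) - cmax \<tau> j)"

definition latest :: "dag_task \<Rightarrow> nat \<Rightarrow> real" where
  "latest \<tau> j = latest' \<tau> j - latest' \<tau> 1"

definition f_U :: "dag_task \<Rightarrow> nat \<Rightarrow> real \<Rightarrow> real" where
  "f_U \<tau> j t = min (max ((t rmod period \<tau>) - earliest \<tau> j) 0) (cmax \<tau> j)"

definition f_L :: "dag_task \<Rightarrow> nat \<Rightarrow> real \<Rightarrow> real" where
  "f_L \<tau> j t = min (max ((t rmod period \<tau>) - latest \<tau> j) 0) (cmax \<tau> j)"

definition F_U :: "dag_task \<Rightarrow> real \<Rightarrow> real" where
  "F_U \<tau> t = of_int \<lfloor>t / period \<tau>\<rfloor> * total_wcet \<tau> + (\<Sum>j\<in>nodes \<tau>. f_U \<tau> j (t rmod period \<tau>))"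

definition F_L :: "dag_task \<Rightarrow> real \<Rightarrow> real" where
  "F_L \<tau> t = of_int \<lfloor>t / period \<tau>\<rfloor> * total_wcet \<tau> + (\<Sum>j\<in>nodes \<tau>. f_L \<tau> j (t rmod period \<tau>))"

text \<open>If the critical path is longer than the period then the maximum over \<open>\<phi>\<close> need not be
  attained, so it is read as a supremum. Lemma \<open>W_NC_is_max\<close> below shows that it is a maximum
  whenever the critical path is at most the period, and lemma \<open>W_NC_bdd_above\<close> that the supremum
  is always finite.\<close>

definition W_NC :: "dag_task \<Rightarrow> real \<Rightarrow> real" where
  "W_NC \<tau> \<Delta> = (SUP \<phi>\<in>{0..crit_length \<tau>}. F_U \<tau> (\<Delta> + \<phi>) - F_L \<tau> \<phi>)"


section \<open>Global fixed task priority schedules\<close>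

text \<open>An activation of task \<open>i\<close> is identified by its release time \<open>r\<close>, and its node \<open>j\<close> by
  the triple \<open>(i, r, j)\<close>. Task \<open>i\<close> is \<open>ts ! i\<close>. \<open>exec_time s i r j\<close> is the amount for which the
  node \<open>j\<close> has to be executed in this activation, and \<open>on_core s p t\<close> is what core \<open>p\<close>
  executes at the instant \<open>t\<close> (\<open>None\<close> if it idles).\<close>

record system_run =
  releases :: "nat \<Rightarrow> real set"
  exec_time :: "nat \<Rightarrow> real \<Rightarrow> nat \<Rightarrow> real"
  on_core :: "nat \<Rightarrow> real \<Rightarrow> (nat \<times> real \<times> nat) option"

definition sporadic_releases :: "dag_task list \<Rightarrow> system_run \<Rightarrow> bool" where
  "sporadic_releases ts s \<longleftrightarrow>
     (\<forall>i<length ts. \<forall>r\<in>releases s i. \<forall>r'\<in>releases s i. r < r' \<longrightarrow> period (ts ! i) \<le> r' - r)"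

definition legal_exec_times :: "dag_task list \<Rightarrow> system_run \<Rightarrow> bool" where
  "legal_exec_times ts s \<longleftrightarrow>
     (\<forall>i<length ts. \<forall>r\<in>releases s i. \<forall>j\<in>nodes (ts ! i).
        exec_time s i r j \<in> {cmin (ts ! i) j..cmax (ts ! i) j})"

definition service :: "nat \<Rightarrow> system_run \<Rightarrow> nat \<Rightarrow> real \<Rightarrow> nat \<Rightarrow> real \<Rightarrow> real" where
  "service m s i r j t =
     (\<Sum>p<m. measure lborel {u \<in> {r..<t}. on_core s p u = Some (i, r, j)})"

text \<open>Quantifying over all ancestors only matters if a node has execution time 0: such a node
  must not count as completed before its ancestors are.\<close>

definition completed :: "dag_task list \<Rightarrow> nat \<Rightarrow> system_run \<Rightarrow> nat \<Rightarrow> real \<Rightarrow> nat \<Rightarrow> real \<Rightarrow> bool" where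
  "completed ts m s i r j t \<longleftrightarrow>
     r \<le> t \<and> (\<forall>x. (x, j) \<in> (edges (ts ! i))\<^sup>* \<longrightarrow> exec_time s i r x \<le> service m s i r x t)"

definition ready :: "dag_task list \<Rightarrow> nat \<Rightarrow> system_run \<Rightarrow> nat \<Rightarrow> real \<Rightarrow> nat \<Rightarrow> real \<Rightarrow> bool" where
  "ready ts m s i r j t \<longleftrightarrow>
     i < length ts \<and> r \<in> releases s i \<and> j \<in> nodes (ts ! i) \<and> r \<le> t \<and>
     (\<forall>x\<in>preds (ts ! i) j. completed ts m s i r x t) \<and> \<not> completed ts m s i r j t"

text \<open>The last conjunct is both work conservation and priority order: a ready node waits only if
  every core is busy with a node of at least its priority (smaller index, higher priority).\<close>

definition gfp_schedule :: "dag_task list \<Rightarrow> nat \<Rightarrow> system_run \<Rightarrow> bool" where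
  "gfp_schedule ts m s \<longleftrightarrow>
     (\<forall>p<m. \<forall>x. {t. on_core s p t = Some x} \<in> sets lborel) \<and>
     (\<forall>t. \<forall>p<m. \<forall>i r j. on_core s p t = Some (i, r, j) \<longrightarrow> ready ts m s i r j t) \<and>
     (\<forall>t. \<forall>p<m. \<forall>q<m. on_core s p t \<noteq> None \<and> on_core s p t = on_core s q t \<longrightarrow> p = q) \<and>
     (\<forall>t i r j. ready ts m s i r j t \<and> (\<forall>p<m. on_core s p t \<noteq> Some (i, r, j)) \<longrightarrow>
        (\<forall>p<m. \<exists>i' r' j'. on_core s p t = Some (i', r', j') \<and> i' \<le> i))"

text \<open>No activation released before \<open>t0\<close> has an uncompleted node at \<open>t0\<close>; a release at \<open>t0\<close>
  itself belongs to the window starting at \<open>t0\<close>.\<close>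

definition no_carry_in :: "dag_task list \<Rightarrow> nat \<Rightarrow> system_run \<Rightarrow> nat \<Rightarrow> real \<Rightarrow> bool" where
  "no_carry_in ts m s i t0 \<longleftrightarrow>
     (\<forall>r\<in>releases s i. r < t0 \<longrightarrow> (\<forall>j\<in>nodes (ts ! i). completed ts m s i r j t0))"

definition workload :: "nat \<Rightarrow> system_run \<Rightarrow> nat \<Rightarrow> real \<Rightarrow> real \<Rightarrow> real" where
  "workload m s i t0 \<Delta> =
     (\<Sum>p<m. measure lborel {t \<in> {t0..<t0 + \<Delta>}. \<exists>r j. on_core s p t = Some (i, r, j)})"


section \<open>Basic facts about the derived quantities\<close>

lemma finite_nodes [simp]: "finite (nodes \<tau>)"
  by (simp add: nodes_def)

lemma dag_wf:
  assumes "sporadic_dag_task \<tau>"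
  shows "wf (edges \<tau>)" "wf ((edges \<tau>)\<inverse>)"
proof -
  have "finite (edges \<tau>)"
    using assms finite_subset[of "edges \<tau>" "nodes \<tau> \<times> nodes \<tau>"] by (auto simp: sporadic_dag_task_def)
  moreover have "acyclic (edges \<tau>)" using assms by (simp add: sporadic_dag_task_def)
  ultimately show "wf (edges \<tau>)" "wf ((edges \<tau>)\<inverse>)"
    by (auto intro: finite_acyclic_wf finite_acyclic_wf_converse)
qed

lemma finite_preds_succs:
  assumes "sporadic_dag_task \<tau>"
  shows "finite (preds \<tau> j)" "finite (succs \<tau> j)"
proof -
  have "preds \<tau> j \<subseteq> nodes \<tau>" "succs \<tau> j \<subseteq> nodes \<tau>"
    using assms by (auto simp: sporadic_dag_task_def preds_def succs_def)
  then show "finite (preds \<tau> j)" "finite (succs \<tau> j)" by (auto intro: finite_subset)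
qed

lemma earliest_entry: "sporadic_dag_task \<tau> \<Longrightarrow> earliest \<tau> 1 = 0"
  unfolding earliest_def by (subst wfrec[OF dag_wf(1)]) auto

lemma earliest_step:
  assumes "sporadic_dag_task \<tau>" "j \<noteq> 1"
  shows "earliest \<tau> j = Max ((\<lambda>x. earliest \<tau> x + cmin \<tau> x) ` preds \<tau> j)"
proof -
  have "(\<lambda>x. cut (earliest \<tau>) (edges \<tau>) j x + cmin \<tau> x) ` preds \<tau> j
      = (\<lambda>x. earliest \<tau> x + cmin \<tau> x) ` preds \<tau> j"
    by (intro image_cong) (auto simp: preds_def cut_apply)
  moreover have "earliest \<tau> j = Max ((\<lambda>x. cut (earliest \<tau>) (edges \<tau>) j x + cmin \<tau> x) ` preds \<tau> j)"
    unfolding earliest_def using assms(2) by (subst wfrec[OF dag_wf(1)[OF assms(1)]]) simp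
  ultimately show ?thesis by simp
qed

lemma latest'_exit: "sporadic_dag_task \<tau> \<Longrightarrow> latest' \<tau> (exit_node \<tau>) = 0"
  unfolding latest'_def by (subst wfrec[OF dag_wf(2)]) auto

lemma latest'_step:
  assumes "sporadic_dag_task \<tau>" "j \<noteq> exit_node \<tau>"
  shows "latest' \<tau> j = Min (latest' \<tau> ` succs \<tau> j) - cmax \<tau> j"
proof -
  have "cut (latest' \<tau>) ((edges \<tau>)\<inverse>) j ` succs \<tau> j = latest' \<tau> ` succs \<tau> j"
    by (intro image_cong) (auto simp: succs_def cut_apply)
  moreover have "latest' \<tau> j = Min (cut (latest' \<tau>) ((edges \<tau>)\<inverse>) j ` succs \<tau> j) - cmax \<tau> j"
    unfolding latest'_def using assms(2) by (subst wfrec[OF dag_wf(2)[OF assms(1)]]) simp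
  ultimately show ?thesis by simp
qed

lemma dag_path_step:
  assumes "successively (\<lambda>x y. (x, y) \<in> E) (x # p)" "y \<in> set p"
  shows "(x, y) \<in> E\<^sup>+"
  using assms
proof (induction p arbitrary: x)
  case (Cons z p)
  then show ?case by (auto intro: trancl_into_trancl2)
qed simp

lemma dag_path_distinct:
  assumes "acyclic E" "successively (\<lambda>x y. (x, y) \<in> E) p"
  shows "distinct p"
  using assms(2)
proof (induction p)
  case (Cons x p)
  have "x \<notin> set p" using dag_path_step[OF Cons.prems] assms(1) by (auto simp: acyclic_def)
  moreover have "distinct p" using Cons by (auto simp: successively_Cons)
  ultimately show ?case by simp
qed simp

lemma finite_dag_paths:
  assumes "sporadic_dag_task \<tau>"
  shows "finite (dag_paths \<tau>)"
proof -
  have "dag_paths \<tau> \<subseteq> {p. set p \<subseteq> nodes \<tau> \<and> distinct p}"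
    using dag_path_distinct assms by (auto simp: dag_paths_def sporadic_dag_task_def)
  then show ?thesis using finite_subset_distinct[OF finite_nodes] finite_subset by blast
qed

lemma crit_length_ge:
  assumes "sporadic_dag_task \<tau>" "p \<in> dag_paths \<tau>"
  shows "(\<Sum>j\<leftarrow>p. cmax \<tau> j) \<le> crit_length \<tau>"
  unfolding crit_length_def using finite_dag_paths[OF assms(1)] assms(2) by (intro Max_ge) auto

lemma entry_in_nodes: "sporadic_dag_task \<tau> \<Longrightarrow> 1 \<in> nodes \<tau>"
  unfolding sporadic_dag_task_def by blast

lemma crit_length_nonneg:
  assumes "sporadic_dag_task \<tau>"
  shows "0 \<le> crit_length \<tau>"
proof -
  have "[1] \<in> dag_paths \<tau>" using entry_in_nodes[OF assms] by (simp add: dag_paths_def)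
  from crit_length_ge[OF assms this] show ?thesis
    using assms entry_in_nodes[OF assms] by (fastforce simp: sporadic_dag_task_def)
qed

lemma latest'_path:
  assumes \<tau>: "sporadic_dag_task \<tau>" and "j \<in> nodes \<tau>"
  shows "latest' \<tau> j \<le> 0 \<and>
         (\<exists>p\<in>dag_paths \<tau>. hd p = j \<and> (\<Sum>x\<leftarrow>p. cmax \<tau> x) = cmax \<tau> (exit_node \<tau>) - latest' \<tau> j)"
  using assms(2)
proof (induction j rule: wf_induct_rule[OF dag_wf(2)[OF \<tau>]])
  case (1 j)
  show ?case
  proof (cases "j = exit_node \<tau>")
    case True
    have "[j] \<in> dag_paths \<tau>" using 1 by (simp add: dag_paths_def)
    then show ?thesis using True latest'_exit[OF \<tau>] by (auto intro!: bexI[of _ "[j]"])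
  next
    case False
    have "succs \<tau> j \<noteq> {}" using False 1 \<tau> unfolding sporadic_dag_task_def by blast
    then have "Min (latest' \<tau> ` succs \<tau> j) \<in> latest' \<tau> ` succs \<tau> j"
      using finite_preds_succs[OF \<tau>] by (intro Min_in) auto
    then obtain x where x: "x \<in> succs \<tau> j" "latest' \<tau> j = latest' \<tau> x - cmax \<tau> j"
      using latest'_step[OF \<tau> False] by auto
    have xn: "x \<in> nodes \<tau>" "(j, x) \<in> edges \<tau>" using x(1) \<tau>
      by (auto simp: sporadic_dag_task_def succs_def)
    with 1 obtain p where p: "latest' \<tau> x \<le> 0" "p \<in> dag_paths \<tau>" "hd p = x"
      "(\<Sum>x\<leftarrow>p. cmax \<tau> x) = cmax \<tau> (exit_node \<tau>) - latest' \<tau> x" by blast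
    have "j # p \<in> dag_paths \<tau>" using p xn 1(2) by (auto simp: dag_paths_def successively_Cons)
    moreover have "0 \<le> cmax \<tau> j" using \<tau> 1(2) by (fastforce simp: sporadic_dag_task_def)
    ultimately show ?thesis using p x(2) by (auto intro!: bexI[of _ "j # p"])
  qed
qed

lemma latest_plus_cmax_le:
  assumes \<tau>: "sporadic_dag_task \<tau>" and j: "j \<in> nodes \<tau>"
  shows "latest \<tau> j + cmax \<tau> j \<le> crit_length \<tau>"
proof -
  obtain p where p: "p \<in> dag_paths \<tau>"
      "(\<Sum>x\<leftarrow>p. cmax \<tau> x) = cmax \<tau> (exit_node \<tau>) - latest' \<tau> 1"
    using latest'_path[OF \<tau> entry_in_nodes[OF \<tau>]] by blast
  have c: "cmax \<tau> (exit_node \<tau>) - latest' \<tau> 1 \<le> crit_length \<tau>"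
    using crit_length_ge[OF \<tau> p(1)] p(2) by simp
  show ?thesis
  proof (cases "j = exit_node \<tau>")
    case True
    then show ?thesis using c latest'_exit[OF \<tau>] by (simp add: latest_def)
  next
    case False
    have "succs \<tau> j \<noteq> {}" using False j \<tau> unfolding sporadic_dag_task_def by blast
    then have "Min (latest' \<tau> ` succs \<tau> j) \<in> latest' \<tau> ` succs \<tau> j"
      using finite_preds_succs[OF \<tau>] by (intro Min_in) auto
    then obtain x where x: "x \<in> succs \<tau> j" "latest' \<tau> j = latest' \<tau> x - cmax \<tau> j"
      using latest'_step[OF \<tau> False] by auto
    have "x \<in> nodes \<tau>" using x(1) \<tau> by (auto simp: sporadic_dag_task_def succs_def)
    then have "latest' \<tau> x \<le> 0" using latest'_path[OF \<tau>] by blast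
    moreover have "exit_node \<tau> \<in> nodes \<tau>" using \<tau> unfolding sporadic_dag_task_def by blast
    then have "0 \<le> cmax \<tau> (exit_node \<tau>)" using \<tau> by (fastforce simp: sporadic_dag_task_def)
    ultimately show ?thesis using c x(2) by (simp add: latest_def)
  qed
qed

lemma total_wcet_nonneg: "sporadic_dag_task \<tau> \<Longrightarrow> 0 \<le> total_wcet \<tau>"
  unfolding total_wcet_def sporadic_dag_task_def by (intro sum_nonneg) fastforce

lemma f_bounds:
  assumes "sporadic_dag_task \<tau>" "j \<in> nodes \<tau>"
  shows "0 \<le> f_L \<tau> j t" "f_U \<tau> j t \<le> cmax \<tau> j"
  using assms by (fastforce simp: f_L_def f_U_def sporadic_dag_task_def)+

lemma W_NC_bdd_above:
  assumes \<tau>: "sporadic_dag_task \<tau>"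
  shows "bdd_above ((\<lambda>\<phi>. F_U \<tau> (\<Delta> + \<phi>) - F_L \<tau> \<phi>) ` {0..crit_length \<tau>})"
proof (rule bdd_aboveI2)
  fix \<phi> assume \<phi>: "\<phi> \<in> {0..crit_length \<tau>}"
  have T: "0 < period \<tau>" using \<tau> by (simp add: sporadic_dag_task_def)
  have "\<lfloor>(\<Delta> + \<phi>) / period \<tau>\<rfloor> \<le> \<lfloor>(\<Delta> + crit_length \<tau>) / period \<tau>\<rfloor>"
    using \<phi> T by (intro floor_mono divide_right_mono) auto
  then have "of_int \<lfloor>(\<Delta> + \<phi>) / period \<tau>\<rfloor> * total_wcet \<tau>
      \<le> of_int \<lfloor>(\<Delta> + crit_length \<tau>) / period \<tau>\<rfloor> * total_wcet \<tau>"
    using total_wcet_nonneg[OF \<tau>] by (intro mult_right_mono) auto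
  moreover have "(\<Sum>j\<in>nodes \<tau>. f_U \<tau> j ((\<Delta> + \<phi>) rmod period \<tau>)) \<le> total_wcet \<tau>"
    unfolding total_wcet_def by (intro sum_mono f_bounds(2)[OF \<tau>])
  moreover have "0 \<le> of_int \<lfloor>\<phi> / period \<tau>\<rfloor> * total_wcet \<tau>"
    using \<phi> T total_wcet_nonneg[OF \<tau>] by (intro mult_nonneg_nonneg) auto
  moreover have "0 \<le> (\<Sum>j\<in>nodes \<tau>. f_L \<tau> j (\<phi> rmod period \<tau>))"
    by (intro sum_nonneg f_bounds(1)[OF \<tau>])
  ultimately show "F_U \<tau> (\<Delta> + \<phi>) - F_L \<tau> \<phi>
      \<le> of_int \<lfloor>(\<Delta> + crit_length \<tau>) / period \<tau>\<rfloor> * total_wcet \<tau> + total_wcet \<tau>"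
    unfolding F_U_def F_L_def by linarith
qed

lemma latest_nonneg:
  assumes \<tau>: "sporadic_dag_task \<tau>" and "j \<in> nodes \<tau>"
  shows "0 \<le> latest \<tau> j"
  using assms(2)
proof (induction j rule: wf_induct_rule[OF dag_wf(1)[OF \<tau>]])
  case (1 j)
  show ?case
  proof (cases "j = 1")
    case False
    then have "preds \<tau> j \<noteq> {}" using 1(2) \<tau> unfolding sporadic_dag_task_def by blast
    then obtain x where x: "(x, j) \<in> edges \<tau>" by (auto simp: preds_def)
    then have xn: "x \<in> nodes \<tau>" using \<tau> by (auto simp: sporadic_dag_task_def)
    have "succs \<tau> (exit_node \<tau>) = {}" using \<tau> unfolding sporadic_dag_task_def by blast
    then have "x \<noteq> exit_node \<tau>" using x by (auto simp: succs_def)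
    then have "latest' \<tau> x \<le> latest' \<tau> j - cmax \<tau> x"
      using latest'_step[OF \<tau>, of x] finite_preds_succs(2)[OF \<tau>, of x] x by (auto simp: succs_def)
    moreover have "0 \<le> cmax \<tau> x" using \<tau> xn by (fastforce simp: sporadic_dag_task_def)
    moreover have "0 \<le> latest \<tau> x" using 1(1) x xn by blast
    ultimately show ?thesis by (simp add: latest_def)
  qed (simp add: latest_def)
qed

lemma W_NC_is_max:
  assumes \<tau>: "sporadic_dag_task \<tau>" and C: "crit_length \<tau> \<le> period \<tau>" and \<Delta>: "0 \<le> \<Delta>"
  shows "\<exists>\<phi>\<in>{0..crit_length \<tau>}. W_NC \<tau> \<Delta> = F_U \<tau> (\<Delta> + \<phi>) - F_L \<tau> \<phi>"
proof -
  define g where "g \<phi> = F_U \<tau> (\<Delta> + \<phi>) - F_L \<tau> \<phi>" for \<phi>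
  define T where "T = period \<tau>"
  define c where "c = crit_length \<tau>"
  define L where "L \<phi> = (\<Sum>j\<in>nodes \<tau>. min (max (\<phi> - latest \<tau> j) 0) (cmax \<tau> j))" for \<phi>
  define U where "U x = (\<Sum>j\<in>nodes \<tau>. min (max (x - earliest \<tau> j) 0) (cmax \<tau> j))" for x
  define h where "h k \<phi> = real k * total_wcet \<tau> + U (\<Delta> + \<phi> - real k * T) - L \<phi>" for k \<phi>
  define K where "K \<phi> = nat \<lfloor>(\<Delta> + \<phi>) / T\<rfloor>" for \<phi>
  have T: "0 < T" using \<tau> by (simp add: sporadic_dag_task_def T_def)
  have c: "0 \<le> c" "c \<le> T" using crit_length_nonneg[OF \<tau>] C by (auto simp: c_def T_def)
  have cpos: "0 \<le> cmax \<tau> j" if "j \<in> nodes \<tau>" for j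
    using \<tau> that by (fastforce simp: sporadic_dag_task_def)
  have C0: "0 \<le> total_wcet \<tau>" by (rule total_wcet_nonneg[OF \<tau>])
  have U: "0 \<le> U x" "U x \<le> total_wcet \<tau>" for x
    unfolding U_def total_wcet_def using cpos by (auto intro!: sum_nonneg sum_mono)
  have FU: "F_U \<tau> (\<Delta> + \<phi>) = real (K \<phi>) * total_wcet \<tau> + U (\<Delta> + \<phi> - real (K \<phi>) * T)"
    if "0 \<le> \<phi>" for \<phi>
  proof -
    have "0 \<le> (\<Delta> + \<phi>) / T" using that \<Delta> T by simp
    then have K: "real (K \<phi>) = of_int \<lfloor>(\<Delta> + \<phi>) / T\<rfloor>" by (simp add: K_def)
    have "(\<Delta> + \<phi>) rmod T = \<Delta> + \<phi> - real (K \<phi>) * T" using T K by (simp add: rmod_def)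
    moreover have "F_U \<tau> (\<Delta> + \<phi>) = of_int \<lfloor>(\<Delta> + \<phi>) / T\<rfloor> * total_wcet \<tau> + U ((\<Delta> + \<phi>) rmod T)"
      by (simp add: F_U_def f_U_def U_def T_def)
    ultimately show ?thesis using K by simp
  qed
  have FL: "F_L \<tau> \<phi> = L \<phi>" if "\<phi> \<in> {0..c}" for \<phi>
  proof (cases "\<phi> < T")
    case True
    then have "\<lfloor>\<phi> / T\<rfloor> = 0" using that T by (simp add: floor_eq_iff)
    moreover then have "\<phi> rmod T = \<phi>" using T by (simp add: rmod_def)
    ultimately show ?thesis by (simp add: F_L_def f_L_def L_def T_def)
  next
    case False
    then have \<phi>: "\<phi> = T" "c = T" using that c by auto
    have "T rmod T = 0" using T by (simp add: rmod_def)
    then have "f_L \<tau> j (T rmod T) = 0" if "j \<in> nodes \<tau>" for j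
      using latest_nonneg[OF \<tau> that] cpos[OF that] by (simp add: f_L_def)
    then have "F_L \<tau> T = total_wcet \<tau>"
      using T by (simp add: F_L_def T_def)
    moreover have "min (max (T - latest \<tau> j) 0) (cmax \<tau> j) = cmax \<tau> j" if "j \<in> nodes \<tau>" for j
      using latest_plus_cmax_le[OF \<tau> that] cpos[OF that] \<phi>(2) by (auto simp: c_def)
    then have "L T = total_wcet \<tau>" by (simp add: L_def total_wcet_def)
    ultimately show ?thesis using \<phi> by simp
  qed
  have gh: "g \<phi> = h (K \<phi>) \<phi>" if "\<phi> \<in> {0..c}" for \<phi>
    using FU[of \<phi>] FL[OF that] that by (simp add: g_def h_def)
  have hg: "h k \<phi> \<le> g \<phi>" if "\<phi> \<in> {0..c}" "real k * T \<le> \<Delta> + \<phi>" for k \<phi>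
  proof -
    have "real k \<le> (\<Delta> + \<phi>) / T" using that T by (simp add: field_simps)
    then have "k \<le> K \<phi>" by (simp add: K_def le_nat_floor)
    then consider "k = K \<phi>" | "Suc k \<le> K \<phi>" by linarith
    then show ?thesis
    proof cases
      case 2
      then have "real (Suc k) * total_wcet \<tau> \<le> real (K \<phi>) * total_wcet \<tau>"
        using C0 by (intro mult_right_mono) auto
      then have "real k * total_wcet \<tau> + total_wcet \<tau> \<le> real (K \<phi>) * total_wcet \<tau>"
        by (simp add: algebra_simps)
      then show ?thesis
        using U(1)[of "\<Delta> + \<phi> - real (K \<phi>) * T"] U(2)[of "\<Delta> + \<phi> - real k * T"] gh[OF that(1)]
        by (simp add: h_def)
    qed (use gh[OF that(1)] in simp)
  qed
  define A where "A k = {0..c} \<inter> {real k * T - \<Delta>..}" for k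
  have KA: "\<phi> \<in> A (K \<phi>)" "K \<phi> \<le> K c" if "\<phi> \<in> {0..c}" for \<phi>
  proof -
    have "0 \<le> (\<Delta> + \<phi>) / T" using that \<Delta> T by simp
    then have "real (K \<phi>) \<le> (\<Delta> + \<phi>) / T" by (simp add: K_def)
    then show "\<phi> \<in> A (K \<phi>)" using that T by (simp add: A_def field_simps)
    show "K \<phi> \<le> K c" unfolding K_def using that T
      by (intro nat_mono floor_mono divide_right_mono) auto
  qed
  have "\<exists>x\<in>A k. \<forall>y\<in>A k. h k y \<le> h k x" if "A k \<noteq> {}" for k
  proof (rule continuous_attains_sup)
    show "compact (A k)" unfolding A_def by (intro compact_Int_closed) auto
    show "continuous_on (A k) (h k)"
      unfolding h_def U_def L_def by (intro continuous_intros)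
  qed (rule that)
  then obtain x where x: "A k \<noteq> {} \<Longrightarrow> x k \<in> A k \<and> (\<forall>y\<in>A k. h k y \<le> h k (x k))" for k by metis
  define S where "S = (\<lambda>k. g (x k)) ` {k. k \<le> K c \<and> A k \<noteq> {}}"
  have "finite S" by (simp add: S_def)
  have "0 \<in> A (K 0)" "K 0 \<le> K c" using KA[of 0] c by auto
  then have "S \<noteq> {}" unfolding S_def by blast
  then have "Max S \<in> S" using \<open>finite S\<close> by simp
  then obtain k where k: "A k \<noteq> {}" "Max S = g (x k)" unfolding S_def by auto
  have xk: "x k \<in> {0..c}" using x[OF k(1)] by (auto simp: A_def)
  have "g \<phi> \<le> g (x k)" if "\<phi> \<in> {0..c}" for \<phi>
  proof -
    have ne: "A (K \<phi>) \<noteq> {}" using KA(1)[OF that] by blast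
    have "g \<phi> \<le> h (K \<phi>) (x (K \<phi>))" using gh[OF that] x[OF ne] KA(1)[OF that] by simp
    also have "\<dots> \<le> g (x (K \<phi>))" using x[OF ne] by (intro hg) (auto simp: A_def)
    also have "\<dots> \<le> Max S" using \<open>finite S\<close> KA(2)[OF that] ne by (intro Max_ge) (auto simp: S_def)
    finally show ?thesis using k(2) by simp
  qed
  then have "W_NC \<tau> \<Delta> = g (x k)"
    unfolding W_NC_def g_def[symmetric] c_def[symmetric] using xk by (intro cSup_eq_maximum) auto
  then show ?thesis using xk by (auto simp: g_def c_def)
qed

end

theory Submission
  imports Defs
begin

text \<open>Without carry-in only activations released inside the window run in it, so the term
  \<open>\<phi> = 0\<close> of the supremum, which is \<open>F_U \<tau> \<Delta>\<close>, already bounds the workload. An activation released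
  at \<open>r\<close> runs its node \<open>j\<close> only after \<open>r + earliest \<tau> j\<close>, on one core at a time and for at most
  \<open>cmax \<tau> j\<close>. At most \<open>\<lfloor>\<Delta> / T\<rfloor> + 1\<close> activations fit in the window, and if there are that many
  then the last one is released at least \<open>\<lfloor>\<Delta> / T\<rfloor> T\<close> after the beginning of the window.\<close>

section \<open>Sets of instants and their Lebesgue measure\<close>

definition running :: "nat \<Rightarrow> system_run \<Rightarrow> nat \<Rightarrow> real \<Rightarrow> nat \<Rightarrow> real set" where
  "running m s i r j = {u. \<exists>p<m. on_core s p u = Some (i, r, j)}"

lemma running_ready:
  assumes "gfp_schedule ts m s" "u \<in> running m s i r j"
  shows "ready ts m s i r j u"
  using assms unfolding gfp_schedule_def running_def by blast

lemma running_on_core_sets: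
  assumes "gfp_schedule ts m s" "p < m"
  shows "{u. on_core s p u = Some x} \<in> sets lborel"
  using assms unfolding gfp_schedule_def by blast

lemma running_sets:
  assumes "gfp_schedule ts m s"
  shows "running m s i r j \<in> sets lborel"
proof -
  have "running m s i r j = (\<Union>p<m. {u. on_core s p u = Some (i, r, j)})"
    by (auto simp: running_def)
  then show ?thesis using running_on_core_sets[OF assms] by auto
qed

text \<open>\<open>measure\<close> is 0 on sets of infinite measure and hence not monotone in
  general, so sets of instants are cut down to a bounded interval before they are compared.\<close>

lemma Int_interval_fmeasurable:
  assumes "B \<in> sets lborel"
  shows "{a..<b::real} \<inter> B \<in> fmeasurable lborel"
proof -
  have "{a..<b} \<in> fmeasurable lborel" 
    by (rule fmeasurableI) (use emeasure_bounded_finite[OF bounded_Ico[of a b]] in auto)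
  then show ?thesis using assms by (rule fmeasurable_Int_fmeasurable)
qed

lemma measure_Int_interval_le:
  assumes "a \<le> b" "B \<in> sets lborel"
  shows "measure lborel ({a..<b::real} \<inter> B) \<le> b - a"
proof -
  have "measure lborel ({a..<b} \<inter> B) \<le> measure lborel ({a..<b} \<inter> UNIV)"
    using assms by (intro measure_mono_fmeasurable Int_interval_fmeasurable) auto
  then show ?thesis using assms(1) by simp
qed

text \<open>A node occupies at most one core at a time, so the sets summed in \<open>service\<close> are disjoint.\<close>

lemma sum_cores_eq_measure_running:
  assumes s: "gfp_schedule ts m s"
  shows "(\<Sum>p<m. measure lborel {u \<in> {a..<b}. on_core s p u = Some (i, r, j)})
    = measure lborel ({a..<b} \<inter> running m s i r j)"
proof -
  define A where "A p = {a..<b} \<inter> {u. on_core s p u = Some (i, r, j)}" for p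
  have "measure lborel (\<Union>p\<in>{..<m}. A p) = (\<Sum>p<m. measure lborel (A p))"
  proof (rule measure_UNION')
    show "A p \<in> fmeasurable lborel" if "p \<in> {..<m}" for p
      unfolding A_def using running_on_core_sets[OF s] that
      by (intro Int_interval_fmeasurable) auto
    have "p = q" if "p < m" "q < m" "on_core s p u = Some (i, r, j)"
        "on_core s q u = Some (i, r, j)" for p q u
      using s that unfolding gfp_schedule_def by (metis option.distinct(1))
    then show "pairwise (\<lambda>p q. disjnt (A p) (A q)) {..<m}"
      by (auto simp: pairwise_def disjnt_def A_def)
  qed simp
  moreover have "(\<Union>p\<in>{..<m}. A p) = {a..<b} \<inter> running m s i r j"
    by (auto simp: A_def running_def)
  moreover have "{u \<in> {a..<b}. on_core s p u = Some (i, r, j)} = A p" for p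
    by (auto simp: A_def)
  ultimately show ?thesis by simp
qed

lemma service_eq_measure_running:
  assumes "gfp_schedule ts m s"
  shows "service m s i r j t = measure lborel ({r..<t} \<inter> running m s i r j)"
  unfolding service_def by (rule sum_cores_eq_measure_running[OF assms])

lemma service_mono:
  assumes s: "gfp_schedule ts m s" and "t \<le> t'"
  shows "service m s i r j t \<le> service m s i r j t'"
proof -
  have "{r..<t} \<inter> running m s i r j \<in> sets lborel"
    using running_sets[OF s] by auto
  then show ?thesis
    unfolding service_eq_measure_running[OF s] using assms(2)
    by (intro measure_mono_fmeasurable Int_interval_fmeasurable running_sets[OF s]) auto
qed

lemma service_increment:
  assumes s: "gfp_schedule ts m s" and "r \<le> t" "t \<le> t'"
  shows "service m s i r j t' \<le>
    service m s i r j t + measure lborel ({t..<t'} \<inter> running m s i r j)"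
proof -
  have "{r..<t'} \<inter> running m s i r j
      = ({r..<t} \<inter> running m s i r j) \<union> ({t..<t'} \<inter> running m s i r j)"
    using assms(2,3) by auto
  moreover have "measure lborel (({r..<t} \<inter> running m s i r j) \<union> ({t..<t'} \<inter> running m s i r j))
      \<le> measure lborel ({r..<t} \<inter> running m s i r j) + measure lborel ({t..<t'} \<inter> running m s i r j)"
    using running_sets[OF s] by (intro measure_Un_le) auto
  ultimately show ?thesis by (simp add: service_eq_measure_running[OF s])
qed

section \<open>Completion and earliest release times\<close>

lemma completed_mono:
  assumes "gfp_schedule ts m s" "t \<le> t'" "completed ts m s i r j t"
  shows "completed ts m s i r j t'"
  using assms service_mono[OF assms(1,2)] unfolding completed_def
  by (meson order_trans)

lemma completed_pred:
  assumes "completed ts m s i r j t" "x \<in> preds (ts ! i) j"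
  shows "completed ts m s i r x t"
  using assms unfolding completed_def preds_def by (auto intro: rtrancl_into_rtrancl)

text \<open>Replaces the two recursion equations by one rule: \<open>0 \<le> a\<close> serves the
  entry node, and for any other node the bounds on the parents bound a \<open>Max\<close> over a
  nonempty set.\<close>

lemma earliest_leI:
  assumes \<tau>: "sporadic_dag_task \<tau>" and j: "j \<in> nodes \<tau>" and "0 \<le> a"
    and "\<And>x. x \<in> preds \<tau> j \<Longrightarrow> earliest \<tau> x + cmin \<tau> x \<le> a"
  shows "earliest \<tau> j \<le> a"
proof (cases "j = 1")
  case True
  then show ?thesis using earliest_entry[OF \<tau>] assms(3) by simp
next
  case False
  then have "preds \<tau> j \<noteq> {}" using j \<tau> unfolding sporadic_dag_task_def by blast
  then show ?thesis
    using earliest_step[OF \<tau> False] finite_preds_succs(1)[OF \<tau>] assms(4) by simp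
qed

text \<open>Being on one core at a time, the node gains service at rate at most 1 from
  \<open>a\<close> on. The maximum with 0 covers instants \<open>t\<close> before
  \<open>a\<close>.\<close>

lemma service_le_after_start:
  assumes s: "gfp_schedule ts m s" and "r \<le> a"
    and start: "\<And>u. u \<in> running m s i r j \<Longrightarrow> a \<le> u"
  shows "service m s i r j t \<le> max (t - a) 0"
proof (cases "a \<le> t")
  case True
  have "{r..<t} \<inter> running m s i r j = {a..<t} \<inter> running m s i r j"
    using start \<open>r \<le> a\<close> by force
  then show ?thesis
    using measure_Int_interval_le[OF True running_sets[OF s]]
    by (simp add: service_eq_measure_running[OF s] max.coboundedI1)
next
  case False
  have "{r..<t} \<inter> running m s i r j = {}" using start False by force
  then show ?thesis by (simp add: service_eq_measure_running[OF s])
qed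

lemma earliest_nonneg:
  assumes \<tau>: "sporadic_dag_task \<tau>" and "j \<in> nodes \<tau>"
  shows "0 \<le> earliest \<tau> j"
  using assms(2)
proof (induction j rule: wf_induct_rule[OF dag_wf(1)[OF \<tau>]])
  case (1 j)
  show ?case
  proof (cases "j = 1")
    case True
    then show ?thesis using earliest_entry[OF \<tau>] by simp
  next
    case False
    then have "preds \<tau> j \<noteq> {}" using 1(2) \<tau> unfolding sporadic_dag_task_def by blast
    then obtain x where x: "x \<in> preds \<tau> j" by blast
    then have xn: "x \<in> nodes \<tau>" "(x, j) \<in> edges \<tau>"
      using \<tau> by (auto simp: sporadic_dag_task_def preds_def)
    have "0 \<le> earliest \<tau> x + cmin \<tau> x"
      using 1(1) xn \<tau> by (auto simp: sporadic_dag_task_def)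
    also have "\<dots> \<le> earliest \<tau> j"
      using earliest_step[OF \<tau> False] finite_preds_succs(1)[OF \<tau>] x by simp
    finally show ?thesis .
  qed
qed

text \<open>Induction along the edges: the induction hypothesis for the parents keeps the node from
  running before \<open>r + earliest (ts ! i) j\<close>, and from then on it needs at least
  \<open>cmin (ts ! i) j\<close> time at unit speed.\<close>

lemma completed_imp_earliest:
  assumes \<tau>: "sporadic_dag_task (ts ! i)" and s: "gfp_schedule ts m s"
    and e: "legal_exec_times ts s" and i: "i < length ts" and r: "r \<in> releases s i"
    and "j \<in> nodes (ts ! i)" "completed ts m s i r j t"
  shows "r + earliest (ts ! i) j + cmin (ts ! i) j \<le> t"
  using assms(6,7)
proof (induction j arbitrary: t rule: wf_induct_rule[OF dag_wf(1)[OF \<tau>]])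
  case (1 j)
  let ?a = "r + earliest (ts ! i) j"
  \<comment> \<open>Stated for any instant \<open>u\<close> because it is used twice: at the
    instants at which the node runs and at the instant \<open>t\<close> at which it is
    completed.\<close>
  have ge: "?a \<le> u" if "r \<le> u" and preds: "\<And>x. x \<in> preds (ts ! i) j \<Longrightarrow> completed ts m s i r x u" for u
  proof -
    have "earliest (ts ! i) x + cmin (ts ! i) x \<le> u - r" if "x \<in> preds (ts ! i) j" for x
    proof -
      have "x \<in> nodes (ts ! i)" "(x, j) \<in> edges (ts ! i)"
        using that \<tau> by (auto simp: sporadic_dag_task_def preds_def)
      then show ?thesis using 1(1)[of x u] preds[OF that] by simp
    qed
    then show ?thesis using earliest_leI[OF \<tau> 1(2), of "u - r"] \<open>r \<le> u\<close> by simp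
  qed
  have "?a \<le> u" if "u \<in> running m s i r j" for u
    using running_ready[OF s that] ge unfolding ready_def by blast
  then have "service m s i r j t \<le> max (t - ?a) 0"
    using earliest_nonneg[OF \<tau> 1(2)] by (intro service_le_after_start[OF s]) auto
  \<comment> \<open>The service bounds give nothing when \<open>cmin (ts ! i) j\<close> is 0. Here
    it matters that \<open>completed\<close> includes the ancestors, so that the parents are
    completed at \<open>t\<close> as well.\<close>
  moreover have "?a \<le> t"
    using 1(3) completed_pred[OF 1(3)] by (intro ge) (auto simp: completed_def)
  moreover have "cmin (ts ! i) j \<le> service m s i r j t"
  proof -
    have "exec_time s i r j \<le> service m s i r j t" using 1(3) by (auto simp: completed_def)
    moreover have "cmin (ts ! i) j \<le> exec_time s i r j"
      using e i r 1(2) unfolding legal_exec_times_def by auto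
    ultimately show ?thesis by simp
  qed
  ultimately show ?case by simp
qed

lemma running_imp_earliest:
  assumes \<tau>: "sporadic_dag_task (ts ! i)" and s: "gfp_schedule ts m s"
    and e: "legal_exec_times ts s" and u: "u \<in> running m s i r j"
  shows "r + earliest (ts ! i) j \<le> u"
proof -
  have rd: "ready ts m s i r j u" by (rule running_ready[OF s u])
  have "earliest (ts ! i) x + cmin (ts ! i) x \<le> u - r" if x: "x \<in> preds (ts ! i) j" for x
  proof -
    have "x \<in> nodes (ts ! i)" using x \<tau> by (auto simp: sporadic_dag_task_def preds_def)
    then have "r + earliest (ts ! i) x + cmin (ts ! i) x \<le> u"
      using rd x by (intro completed_imp_earliest[OF \<tau> s e]) (auto simp: ready_def)
    then show ?thesis by simp
  qed
  then show ?thesis using earliest_leI[OF \<tau>, of j "u - r"] rd by (simp add: ready_def)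
qed

text \<open>A ready node is not completed, but a priori an ancestor could be the cause. Every proper
  ancestor reaches the node through a parent, and a completed parent has all its ancestors fully
  served, so the node itself must lack service.\<close>

lemma ready_imp_service_less:
  assumes "ready ts m s i r j t"
  shows "service m s i r j t < exec_time s i r j"
proof (rule ccontr)
  assume "\<not> service m s i r j t < exec_time s i r j"
  moreover have "exec_time s i r x \<le> service m s i r x t"
    if x: "(x, j) \<in> (edges (ts ! i))\<^sup>*" "x \<noteq> j" for x
  proof -
    obtain y where "(x, y) \<in> (edges (ts ! i))\<^sup>*" "(y, j) \<in> edges (ts ! i)"
      using x by (metis rtranclE)
    then show ?thesis using assms by (auto simp: ready_def preds_def completed_def)
  qed
  ultimately have "completed ts m s i r j t"
    using assms unfolding completed_def ready_def by force
  then show False using assms by (simp add: ready_def)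
qed

text \<open>Service grows continuously from 0, so to exceed the execution time it would have to pass
  through it exactly; from that instant on the node is no longer ready and gains nothing
  more.\<close>

lemma service_le_exec_time:
  assumes s: "gfp_schedule ts m s" and "0 \<le> exec_time s i r j"
  shows "service m s i r j t \<le> exec_time s i r j"
proof (rule ccontr)
  let ?g = "service m s i r j"
  assume gt: "\<not> ?g t \<le> exec_time s i r j"
  have gr: "?g r = 0" by (simp add: service_eq_measure_running[OF s])
  have "r \<le> t"
  proof (rule ccontr)
    assume "\<not> r \<le> t"
    then have "?g t \<le> 0" using service_mono[OF s, of t r] gr by (metis linear)
    then show False using gt assms(2) by simp
  qed
  \<comment> \<open>One core at a time means growth at rate at most 1; together with monotonicity
    this is the Lipschitz condition.\<close>
  have lip: "?g v \<le> ?g u + (v - u)" if "r \<le> u" "u \<le> v" for u v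
    using service_increment[OF s that, of i j]
      measure_Int_interval_le[OF that(2) running_sets[OF s], of i r j] by linarith
  have "1-lipschitz_on {r..t} ?g"
  proof (rule lipschitz_onI)
    show "dist (?g u) (?g v) \<le> 1 * dist u v" if "u \<in> {r..t}" "v \<in> {r..t}" for u v
      using lip[of u v] lip[of v u] service_mono[OF s, of u v i r j]
        service_mono[OF s, of v u i r j] that
      by (cases "u \<le> v") (auto simp: dist_real_def)
  qed simp
  then have "continuous_on {r..t} ?g" by (rule lipschitz_on_continuous_on)
  then obtain v where v: "r \<le> v" "v \<le> t" "?g v = exec_time s i r j"
    using IVT'[of ?g r "exec_time s i r j" t] gr gt assms(2) \<open>r \<le> t\<close> by auto
  have "u \<notin> running m s i r j" if "v \<le> u" for u
    using ready_imp_service_less[OF running_ready[OF s]] service_mono[OF s that] v(3)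
    by (metis not_less)
  then have "{v..<t} \<inter> running m s i r j = {}" by auto
  then have "?g t \<le> ?g v" using service_increment[OF s v(1,2), of i j] by simp
  then show False using gt v(3) by simp
qed

section \<open>Work of a single activation\<close>

text \<open>The sum over the nodes in \<open>F_U\<close>, but without reduction modulo the period,
  since the age \<open>t\<close> of an activation at the end of the window may exceed the
  period.\<close>

definition max_work :: "dag_task \<Rightarrow> real \<Rightarrow> real" where
  "max_work \<tau> t = (\<Sum>j\<in>nodes \<tau>. min (max (t - earliest \<tau> j) 0) (cmax \<tau> j))"

lemma max_work_bounds:
  assumes "sporadic_dag_task \<tau>"
  shows "0 \<le> max_work \<tau> t" "max_work \<tau> t \<le> total_wcet \<tau>"
proof -
  have "0 \<le> cmax \<tau> j" if "j \<in> nodes \<tau>" for j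
    using assms that by (fastforce simp: sporadic_dag_task_def)
  then show "0 \<le> max_work \<tau> t" "max_work \<tau> t \<le> total_wcet \<tau>"
    unfolding max_work_def total_wcet_def by (auto intro!: sum_nonneg sum_mono)
qed

lemma max_work_mono: "t \<le> t' \<Longrightarrow> max_work \<tau> t \<le> max_work \<tau> t'"
  unfolding max_work_def by (intro sum_mono) (auto intro: min.mono max.mono)

text \<open>Each node is capped twice: by the time elapsed since its earliest start, and by its
  execution time, which is at most \<open>cmax\<close>.\<close>

lemma service_sum_le_max_work:
  assumes \<tau>: "sporadic_dag_task (ts ! i)" and s: "gfp_schedule ts m s"
    and e: "legal_exec_times ts s" and i: "i < length ts" and r: "r \<in> releases s i"
  shows "(\<Sum>j\<in>nodes (ts ! i). service m s i r j t) \<le> max_work (ts ! i) (t - r)"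
  unfolding max_work_def
proof (rule sum_mono)
  fix j assume j: "j \<in> nodes (ts ! i)"
  have "exec_time s i r j \<in> {cmin (ts ! i) j..cmax (ts ! i) j}"
    using e i r j unfolding legal_exec_times_def by blast
  moreover have "0 \<le> cmin (ts ! i) j" using \<tau> j by (simp add: sporadic_dag_task_def)
  ultimately have ex: "0 \<le> exec_time s i r j" "exec_time s i r j \<le> cmax (ts ! i) j" by auto
  have "service m s i r j t \<le> max (t - (r + earliest (ts ! i) j)) 0"
    using running_imp_earliest[OF \<tau> s e] earliest_nonneg[OF \<tau> j]
    by (intro service_le_after_start[OF s]) auto
  moreover have "service m s i r j t \<le> cmax (ts ! i) j"
    using service_le_exec_time[OF s ex(1)] ex(2) by (rule order_trans)
  ultimately show "service m s i r j t
      \<le> min (max (t - r - earliest (ts ! i) j) 0) (cmax (ts ! i) j)"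
    by (simp add: algebra_simps)
qed

section \<open>Counting activations in the window\<close>

text \<open>Elements are inserted in increasing order, each at least \<open>T\<close> above the
  previous maximum. Subtracting 1 in the reals avoids truncated subtraction and leaves just
  \<open>a\<close> for a singleton.\<close>

lemma Max_separated_ge:
  fixes R :: "real set"
  assumes "finite R" "R \<noteq> {}" "\<And>r. r \<in> R \<Longrightarrow> a \<le> r"
    and "\<And>r r'. r \<in> R \<Longrightarrow> r' \<in> R \<Longrightarrow> r < r' \<Longrightarrow> T \<le> r' - r"
  shows "a + (real (card R) - 1) * T \<le> Max R"
  using assms
proof (induction R rule: finite_linorder_max_induct)
  case (insert b A)
  have b: "Max (insert b A) = b" "b \<notin> A"
    using insert(1,2) by (auto intro!: Max_eqI intro: less_imp_le)
  show ?case
  proof (cases "A = {}")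
    case False
    have "a + (real (card A) - 1) * T \<le> Max A" using insert False by simp
    moreover have "Max A \<in> A" using insert(1) False by simp
    then have "T \<le> b - Max A" using insert by auto
    ultimately show ?thesis using b insert(1) by (simp add: algebra_simps)
  qed (use b insert in simp)
qed simp

text \<open>A finite subset with k elements spans at least (k - 1) T and lies in a window of length
  \<Delta>, so k - 1 is at most the floor. Finiteness of \<open>R\<close> is not assumed: a bound
  common to all finite subsets implies it.\<close>

lemma separated_card_le:
  fixes R :: "real set"
  assumes "0 < T" "0 \<le> \<Delta>" and R: "R \<subseteq> {a..<a + \<Delta>}"
    and sep: "\<And>r r'. r \<in> R \<Longrightarrow> r' \<in> R \<Longrightarrow> r < r' \<Longrightarrow> T \<le> r' - r"
  shows "finite R" "card R \<le> Suc (nat \<lfloor>\<Delta> / T\<rfloor>)"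
proof -
  have c: "card S \<le> Suc (nat \<lfloor>\<Delta> / T\<rfloor>)" if "finite S" "S \<subseteq> R" for S
  proof (cases "S = {}")
    case False
    then have "Max S \<in> S" using that by simp
    then have "Max S < a + \<Delta>" using R that by auto
    moreover have "a + (real (card S) - 1) * T \<le> Max S"
      using that False R sep by (intro Max_separated_ge) (auto simp: subset_iff)
    ultimately have "(real (card S) - 1) * T < \<Delta>" by simp
    then have "real (card S) - 1 \<le> \<Delta> / T" using assms(1) by (simp add: field_simps)
    moreover have "1 \<le> card S" using False that by (simp add: Suc_le_eq card_gt_0_iff)
    ultimately have "card S - 1 \<le> nat \<lfloor>\<Delta> / T\<rfloor>" by (intro le_nat_floor) (simp add: of_nat_diff)
    then show ?thesis by simp
  qed simp
  show "finite R"
  proof (rule ccontr)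
    assume "infinite R"
    then obtain S where "finite S" "S \<subseteq> R" "card S = Suc (Suc (nat \<lfloor>\<Delta> / T\<rfloor>))"
      using infinite_arbitrarily_large by metis
    then show False using c by fastforce
  qed
  then show "card R \<le> Suc (nat \<lfloor>\<Delta> / T\<rfloor>)" using c by blast
qed

text \<open>For nonnegative \<Delta> the floor is the natural number \<open>n\<close>, and reduction
  modulo the period subtracts \<open>n\<close> periods; the second reduction inside
  \<open>f_U\<close> changes nothing.\<close>

lemma F_U_eq_max_work:
  assumes \<tau>: "sporadic_dag_task \<tau>" and "0 \<le> \<Delta>"
  defines "n \<equiv> nat \<lfloor>\<Delta> / period \<tau>\<rfloor>"
  shows "F_U \<tau> \<Delta> = real n * total_wcet \<tau> + max_work \<tau> (\<Delta> - real n * period \<tau>)"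
proof -
  have T: "0 < period \<tau>" using \<tau> by (simp add: sporadic_dag_task_def)
  have n: "of_int \<lfloor>\<Delta> / period \<tau>\<rfloor> = real n" using T assms(2) by (simp add: n_def)
  then have "\<Delta> rmod period \<tau> = \<Delta> - real n * period \<tau>" using T by (simp add: rmod_def)
  moreover have "F_U \<tau> \<Delta>
      = of_int \<lfloor>\<Delta> / period \<tau>\<rfloor> * total_wcet \<tau> + max_work \<tau> (\<Delta> rmod period \<tau>)"
    by (simp add: F_U_def f_U_def max_work_def)
  ultimately show ?thesis using n by simp
qed

text \<open>Up to \<open>n\<close> activations contribute at most \<open>total_wcet \<tau>\<close>
  each. If there is one more, the last is released so late that its age at the end of the window is
  at most the remainder of \<Delta>, and the other \<open>n\<close> are counted in full.\<close>

lemma sum_max_work_le_F_U: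
  assumes \<tau>: "sporadic_dag_task \<tau>" and "0 \<le> \<Delta>" and R: "R \<subseteq> {a..<a + \<Delta>}"
    and sep: "\<And>r r'. r \<in> R \<Longrightarrow> r' \<in> R \<Longrightarrow> r < r' \<Longrightarrow> period \<tau> \<le> r' - r"
  shows "(\<Sum>r\<in>R. max_work \<tau> (a + \<Delta> - r)) \<le> F_U \<tau> \<Delta>"
proof -
  define n where "n = nat \<lfloor>\<Delta> / period \<tau>\<rfloor>"
  have T: "0 < period \<tau>" using \<tau> by (simp add: sporadic_dag_task_def)
  have fin: "finite R" and card: "card R \<le> Suc n"
    using separated_card_le[OF T assms(2) R sep] by (auto simp: n_def)
  \<comment> \<open>Applied to \<open>R\<close> itself in the first case below and to
    \<open>R - {Max R}\<close> in the second.\<close>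
  have C: "(\<Sum>r\<in>S. max_work \<tau> (a + \<Delta> - r)) \<le> real n * total_wcet \<tau>" if "card S \<le> n" for S
  proof -
    have "(\<Sum>r\<in>S. max_work \<tau> (a + \<Delta> - r)) \<le> real (card S) * total_wcet \<tau>"
      using max_work_bounds(2)[OF \<tau>] by (rule sum_bounded_above)
    also have "\<dots> \<le> real n * total_wcet \<tau>"
      using that total_wcet_nonneg[OF \<tau>] by (intro mult_right_mono) auto
    finally show ?thesis .
  qed
  have "(\<Sum>r\<in>R. max_work \<tau> (a + \<Delta> - r))
      \<le> real n * total_wcet \<tau> + max_work \<tau> (\<Delta> - real n * period \<tau>)"
  proof (cases "card R \<le> n")
    case True
    then show ?thesis using C max_work_bounds(1)[OF \<tau>] by (simp add: add_increasing2)
  next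
    case False
    then have cR: "card R = Suc n" using card by simp
    then have ne: "R \<noteq> {}" by auto
    then have MR: "Max R \<in> R" using fin by simp
    have "a + (real (card R) - 1) * period \<tau> \<le> Max R"
      using fin ne R sep by (intro Max_separated_ge) auto
    then have "max_work \<tau> (a + \<Delta> - Max R) \<le> max_work \<tau> (\<Delta> - real n * period \<tau>)"
      using cR by (intro max_work_mono) simp
    moreover have "(\<Sum>r\<in>R - {Max R}. max_work \<tau> (a + \<Delta> - r)) \<le> real n * total_wcet \<tau>"
      using cR MR fin by (intro C) simp
    ultimately show ?thesis
      using sum.remove[OF fin MR, of "\<lambda>r. max_work \<tau> (a + \<Delta> - r)"] by simp
  qed
  then show ?thesis using F_U_eq_max_work[OF \<tau> assms(2)] by (simp add: n_def)
qed

section \<open>Comparison with the supremum and the workload bound\<close>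

text \<open>The choice \<phi> = 0 is admissible because the critical path length is nonnegative, and
  \<open>F_L \<tau> 0\<close> vanishes because latest release times are nonnegative. Boundedness
  from above lets the supremum dominate this term.\<close>

lemma F_U_le_W_NC:
  assumes \<tau>: "sporadic_dag_task \<tau>"
  shows "F_U \<tau> \<Delta> \<le> W_NC \<tau> \<Delta>"
proof -
  have "f_L \<tau> j 0 = 0" if "j \<in> nodes \<tau>" for j
  proof -
    have "0 \<le> cmax \<tau> j" using \<tau> that by (fastforce simp: sporadic_dag_task_def)
    then show ?thesis using latest_nonneg[OF \<tau> that] by (simp add: f_L_def)
  qed
  then have "F_L \<tau> 0 = 0" by (simp add: F_L_def)
  then show ?thesis
    unfolding W_NC_def using crit_length_nonneg[OF \<tau>]
    by (intro cSUP_upper2[OF W_NC_bdd_above[OF \<tau>], of 0]) auto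
qed

theorem lemma3:
  fixes ts :: "dag_task list" and m i :: nat and s :: system_run and t0 \<Delta> :: real
  assumes "0 < m"
    and "\<forall>\<tau>\<in>set ts. sporadic_dag_task \<tau>"
    and "sporadic_releases ts s"
    and "legal_exec_times ts s"
    and "gfp_schedule ts m s"
    and "i < length ts"
    and "deadline (ts ! i) \<le> period (ts ! i)"
    and "0 \<le> \<Delta>"
    and "no_carry_in ts m s i t0"
  shows "workload m s i t0 \<Delta> \<le> W_NC (ts ! i) \<Delta>"
proof -
  note s = assms(5)
  let ?\<tau> = "ts ! i"
  let ?N = "nodes ?\<tau>"
  define R where "R = releases s i \<inter> {t0..<t0 + \<Delta>}"
  have \<tau>: "sporadic_dag_task ?\<tau>" using assms(2,6) by simp
  have T: "0 < period ?\<tau>" using \<tau> by (simp add: sporadic_dag_task_def)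
  have sep: "period ?\<tau> \<le> r' - r" if "r \<in> R" "r' \<in> R" "r < r'" for r r'
    using assms(3,6) that unfolding sporadic_releases_def R_def by blast
  have RI: "R \<subseteq> {t0..<t0 + \<Delta>}" by (simp add: R_def)
  have fin: "finite R" using separated_card_le(1)[OF T assms(8) RI sep] .
  \<comment> \<open>Splits the workload of each core by activation and node, \<open>x\<close> being
    the pair of release time and node.\<close>
  define A where "A p x = {u \<in> {t0..<t0 + \<Delta>}. on_core s p u = Some (i, fst x, snd x)}" for p x
  have A_sets: "A p x \<in> sets lborel" if "p < m" for p x
  proof -
    have "A p x = {t0..<t0 + \<Delta>} \<inter> {u. on_core s p u = Some (i, fst x, snd x)}"
      by (auto simp: A_def)
    then show ?thesis using running_on_core_sets[OF s that] by auto
  qed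
  \<comment> \<open>An activation released before \<open>t0\<close> is completed at
    \<open>t0\<close> since there is no carry-in, and it stays completed, so none of its nodes is
    ready in the window.\<close>
  have *: "r \<in> R \<and> j \<in> ?N"
    if u: "u \<in> {t0..<t0 + \<Delta>}" "p < m" "on_core s p u = Some (i, r, j)" for u p r j
  proof -
    have rd: "ready ts m s i r j u"
      using u s running_ready[of ts m s u i r j] by (auto simp: running_def)
    have "t0 \<le> r"
    proof (rule ccontr)
      assume "\<not> t0 \<le> r"
      then have "completed ts m s i r j t0"
        using assms(9) rd by (auto simp: no_carry_in_def ready_def)
      then show False using completed_mono[OF s, of t0 u] u(1) rd by (auto simp: ready_def)
    qed
    then show ?thesis using rd u(1) by (auto simp: ready_def R_def)
  qed
  have "workload m s i t0 \<Delta> \<le> (\<Sum>p<m. \<Sum>x\<in>R \<times> ?N. measure lborel (A p x))"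
    unfolding workload_def
  proof (rule sum_mono)
    fix p assume "p \<in> {..<m}"
    then have p: "p < m" by simp
    have "{t \<in> {t0..<t0 + \<Delta>}. \<exists>r j. on_core s p t = Some (i, r, j)} = (\<Union>x\<in>R \<times> ?N. A p x)"
      using *[OF _ p] by (fastforce simp: A_def)
    \<comment> \<open>Subadditivity is enough for an upper bound; finiteness of \<open>R\<close>
      keeps the union finite.\<close>
    moreover have "measure lborel (\<Union>x\<in>R \<times> ?N. A p x) \<le> (\<Sum>x\<in>R \<times> ?N. measure lborel (A p x))"
      using fin A_sets[OF p] by (intro measure_UNION_le) auto
    ultimately show "measure lborel {t \<in> {t0..<t0 + \<Delta>}. \<exists>r j. on_core s p t = Some (i, r, j)}
        \<le> (\<Sum>x\<in>R \<times> ?N. measure lborel (A p x))" by simp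
  qed
  \<comment> \<open>With the sum over cores innermost, it collapses for each fixed node to the
    measure of a single \<open>running\<close> set.\<close>
  also have "\<dots> = (\<Sum>x\<in>R \<times> ?N. \<Sum>p<m. measure lborel (A p x))"
    by (rule sum.swap)
  also have "\<dots> \<le> (\<Sum>x\<in>R \<times> ?N. service m s i (fst x) (snd x) (t0 + \<Delta>))"
  proof (rule sum_mono)
    fix x assume "x \<in> R \<times> ?N"
    let ?B = "running m s i (fst x) (snd x)"
    \<comment> \<open>A node runs only from its release on, so its execution in the window is
      covered by what \<open>service\<close> counts from the release.\<close>
    have "fst x \<le> u" if "u \<in> ?B" for u
      using running_ready[OF s that] by (simp add: ready_def)
    then have "measure lborel ({t0..<t0 + \<Delta>} \<inter> ?B) \<le> measure lborel ({fst x..<t0 + \<Delta>} \<inter> ?B)"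
      using running_sets[OF s] by (intro measure_mono_fmeasurable Int_interval_fmeasurable) auto
    then show "(\<Sum>p<m. measure lborel (A p x)) \<le> service m s i (fst x) (snd x) (t0 + \<Delta>)"
      unfolding A_def sum_cores_eq_measure_running[OF s] service_eq_measure_running[OF s] .
  qed
  also have "\<dots> = (\<Sum>r\<in>R. \<Sum>j\<in>?N. service m s i r j (t0 + \<Delta>))"
    by (simp add: sum.cartesian_product case_prod_beta)
  also have "\<dots> \<le> (\<Sum>r\<in>R. max_work ?\<tau> (t0 + \<Delta> - r))"
    by (intro sum_mono service_sum_le_max_work[OF \<tau> s assms(4,6)]) (simp add: R_def)
  also have "\<dots> \<le> F_U ?\<tau> \<Delta>" by (rule sum_max_work_le_F_U[OF \<tau> assms(8) RI sep])
  also have "\<dots> \<le> W_NC ?\<tau> \<Delta>" by (rule F_U_le_W_NC[OF \<tau>])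
  finally show ?thesis .
qed

end
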